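(* Let $\mathcal{R}$ be an associative ring with unit $1\neq 0$, let $a\in\mathcal{R}$, let $\mathcal{S}$ be a right ideal of $\mathcal{R}$ and let $\mathcal{S}'$ be a left ideal of $\mathcal{R}$. Then the following statements are equivalent: (1) There exists $x\in a\{2\}$ such that $x\mathcal{R}=\mathcal{S}$ and $\mathcal{R}x=\mathcal{S}'$. (2) $\mathcal{R}=a\mathcal{S}\oplus{\rm rann}(\mathcal{S}')$ and $\mathcal{R}=\mathcal{S}'a\oplus{\rm lann}(\mathcal{S})$. (3) There exists $x\in\mathcal{S}\cap\mathcal{S}'$ such that $xas=s$ for all $s\in\mathcal{S}$ and $sax=s$ for all $s\in\mathcal{S}'$. (4) There exists $x\in\mathcal{S}\cap\mathcal{S}'$ such that $\varphi_{ax}=\rho_{a\mathcal{S},\,{\rm rann}(\mathcal{S}')}$ and ${}_{xa}\varphi=\rho_{\mathcal{S}'a,\,{\rm lann}(\mathcal{S})}$. Moreover, if an element $x\in a\{2\}$ such that $x\mathcal{R}=\mathcal{S}$ and $\mathcal{R}x=\mathcal{S}'$ exists, then it is unique, and it is equal to $a^{(2)}_{{\rm rprin}=\mathcal{S},{\rm rann}={\rm rann}(\mathcal{S}')}$ and to $a^{(2)}_{{\rm lprin}=\mathcal{S}',{\rm lann}={\rm lann}(\mathcal{S})}$.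
   Context: Notation: $a\{2\}=\{x\in\mathcal{R}:xax=x\}$; $a\mathcal{R}=\{ar:r\in\mathcal{R}\}$, $\mathcal{R}a=\{ra:r\in\mathcal{R}\}$, $a\mathcal{S}=\{as:s\in\mathcal{S}\}$, $\mathcal{S}'a=\{sa:s\in\mathcal{S}'\}$; ${\rm rann}(a)=\{r:ar=0\}$, ${\rm lann}(a)=\{r:ra=0\}$, and for $\mathcal{A}\subseteq\mathcal{R}$, ${\rm rann}(\mathcal{A})=\{r\in\mathcal{R}:ar=0\ \forall a\in\mathcal{A}\}$, ${\rm lann}(\mathcal{A})=\{r\in\mathcal{R}:ra=0\ \forall a\in\mathcal{A}\}$. The additive group endomorphisms $\varphi_a,{}_a\varphi$ of $\mathcal{R}$ are $\varphi_a(r)=ar$, ${}_a\varphi(r)=ra$. For additive subgroups $\mathcal{S},\mathcal{T}$ of $\mathcal{R}$, $\mathcal{R}=\mathcal{S}\oplus\mathcal{T}$ means $\mathcal{R}=\mathcal{S}+\mathcal{T}$ and $\mathcal{S}\cap\mathcal{T}=\{0\}$; then $\rho_{\mathcal{S},\mathcal{T}}:\mathcal{R}\to\mathcal{R}$ is the group endomorphism $\rho_{\mathcal{S},\mathcal{T}}(s+t)=s$ for $s\in\mathcal{S}$, $t\in\mathcal{T}$. Convention: whenever $\rho_{\mathcal{S},\mathcal{T}}$ is written, it is implicitly asserted that $\mathcal{R}=\mathcal{S}\oplus\mathcal{T}$. For right ideals $\mathcal{S},\mathcal{T}$, $a^{(2)}_{{\rm rprin}=\mathcal{S},{\rm rann}=\mathcal{T}}$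 is the (unique, if it exists) $x\in a\{2\}$ with $x\mathcal{R}=\mathcal{S}$, ${\rm rann}(x)=\mathcal{T}$; for left ideals $\mathcal{S}',\mathcal{T}'$, $a^{(2)}_{{\rm lprin}=\mathcal{S}',{\rm lann}=\mathcal{T}'}$ is the (unique, if it exists) $x\in a\{2\}$ with $\mathcal{R}x=\mathcal{S}'$, ${\rm lann}(x)=\mathcal{T}'$. *)

theory Defs
  imports Main "HOL-Library.Set_Algebras"
begin

definition left_mult :: "'a::ring_1 \<Rightarrow> 'a \<Rightarrow> 'a"
  where "left_mult a = (\<lambda>r. a * r)"

definition right_mult :: "'a::ring_1 \<Rightarrow> 'a \<Rightarrow> 'a"
  where "right_mult a = (\<lambda>r. r * a)"

definition add_subgroup :: "'a::ring_1 set \<Rightarrow> bool"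
  where "add_subgroup S \<longleftrightarrow> 0 \<in> S \<and> (\<forall>s\<in>S. \<forall>t\<in>S. s + t \<in> S) \<and> (\<forall>s\<in>S. - s \<in> S)"

definition right_ideal :: "'a::ring_1 set \<Rightarrow> bool"
  where "right_ideal S \<longleftrightarrow> add_subgroup S \<and> (\<forall>s\<in>S. \<forall>r. s * r \<in> S)"

definition left_ideal :: "'a::ring_1 set \<Rightarrow> bool"
  where "left_ideal S \<longleftrightarrow> add_subgroup S \<and> (\<forall>s\<in>S. \<forall>r. r * s \<in> S)"

definition rann :: "'a::ring_1 \<Rightarrow> 'a set"
  where "rann a = {r. a * r = 0}"

definition lann :: "'a::ring_1 \<Rightarrow> 'a set"
  where "lann a = {r. r * a = 0}"

definition rann_set :: "'a::ring_1 set \<Rightarrow> 'a set"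
  where "rann_set A = {r. \<forall>a\<in>A. a * r = 0}"

definition lann_set :: "'a::ring_1 set \<Rightarrow> 'a set"
  where "lann_set A = {r. \<forall>a\<in>A. r * a = 0}"

text \<open>The whole ring is the direct sum of \<open>S\<close> and \<open>T\<close>; meant for additive subgroups only.
  The \<open>+\<close> is the elementwise sum of sets.\<close>

definition direct_sum :: "'a::ring_1 set \<Rightarrow> 'a set \<Rightarrow> bool"
  where "direct_sum S T \<longleftrightarrow> UNIV = S + T \<and> S \<inter> T = {0}"

text \<open>The projection onto \<open>S\<close> along \<open>T\<close>. It is unspecified unless \<open>direct_sum S T\<close>, so the
  convention that writing it asserts the decomposition must be stated separately.\<close>

definition proj :: "'a::ring_1 set \<Rightarrow> 'a set \<Rightarrow> 'a \<Rightarrow> 'a"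
  where "proj S T r = (THE s. s \<in> S \<and> (\<exists>t\<in>T. r = s + t))"

definition is_proj :: "('a::ring_1 \<Rightarrow> 'a) \<Rightarrow> 'a set \<Rightarrow> 'a set \<Rightarrow> bool"
  where "is_proj f S T \<longleftrightarrow> direct_sum S T \<and> f = proj S T"

lemma proj_add:
  assumes "add_subgroup S" "add_subgroup T" "direct_sum S T" "s \<in> S" "t \<in> T"
  shows "proj S T (s + t) = s"
  unfolding proj_def
proof (rule the_equality)
  show "s \<in> S \<and> (\<exists>t'\<in>T. s + t = s + t')" using assms by blast
next
  fix s' assume "s' \<in> S \<and> (\<exists>t'\<in>T. s + t = s' + t')"
  then obtain t' where s': "s' \<in> S" and t': "t' \<in> T" and eq: "s + t = s' + t'" by blast
  have "s' + - s \<in> S" "t + - t' \<in> T"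
    using assms s' t' unfolding add_subgroup_def by blast+
  moreover have "s' + - s = t + - t'"
    using eq by (simp add: algebra_simps)
  ultimately have "s' + - s \<in> S \<inter> T" by simp
  then show "s' = s" using assms(3) unfolding direct_sum_def by simp
qed

definition outer_inverses :: "'a::ring_1 \<Rightarrow> 'a set"
  where "outer_inverses a = {x. x * a * x = x}"

definition is_outer_rprin_rann :: "'a::ring_1 \<Rightarrow> 'a set \<Rightarrow> 'a set \<Rightarrow> 'a \<Rightarrow> bool"
  where "is_outer_rprin_rann a S T x \<longleftrightarrow>
    x \<in> outer_inverses a \<and> left_mult x ` UNIV = S \<and> rann x = T"

definition is_outer_lprin_lann :: "'a::ring_1 \<Rightarrow> 'a set \<Rightarrow> 'a set \<Rightarrow> 'a \<Rightarrow> bool"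
  where "is_outer_lprin_lann a S T x \<longleftrightarrow>
    x \<in> outer_inverses a \<and> right_mult x ` UNIV = S \<and> lann x = T"

text \<open>Both are unspecified unless the corresponding predicate has exactly one witness.\<close>

definition outer_rprin_rann :: "'a::ring_1 \<Rightarrow> 'a set \<Rightarrow> 'a set \<Rightarrow> 'a"
  where "outer_rprin_rann a S T = (THE x. is_outer_rprin_rann a S T x)"

definition outer_lprin_lann :: "'a::ring_1 \<Rightarrow> 'a set \<Rightarrow> 'a set \<Rightarrow> 'a"
  where "outer_lprin_lann a S T = (THE x. is_outer_lprin_lann a S T x)"

definition is_outer_rprin_lprin :: "'a::ring_1 \<Rightarrow> 'a set \<Rightarrow> 'a set \<Rightarrow> 'a \<Rightarrow> bool"
  where "is_outer_rprin_lprin a S S' x \<longleftrightarrow>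
    x \<in> outer_inverses a \<and> left_mult x ` UNIV = S \<and> right_mult x ` UNIV = S'"

end

theory Submission
  imports Defs
begin

text \<open>Everything is read off from the pair of absorption laws \<open>x * a * s = s\<close> on \<open>S\<close> and
  \<open>s * a * x = s\<close> on \<open>S'\<close>, for an \<open>x\<close> in \<open>S \<inter> S'\<close>. They say that \<open>x\<close> is an outer inverse of
  \<open>a\<close> with \<open>x R = S\<close> and \<open>R x = S'\<close>, where \<open>R\<close> is the ring (\<open>outer_inverse_iff_absorbs\<close>).
  They also make \<open>a * x\<close> and \<open>x * a\<close> idempotents whose multiplications split the ring:
  \<open>r = a * x * r + (r - a * x * r)\<close> has its first summand in \<open>a S\<close> and its second one annihilated
  by \<open>S'\<close>, and symmetrically on the other side.

  Conversely, the two decompositions give \<open>x\<close> by decomposing the unit. If \<open>1 = a * p + t\<close> with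
  \<open>p\<close> in \<open>S\<close> and \<open>S' t = 0\<close>, then \<open>s * a * p = s\<close> on \<open>S'\<close>; if \<open>1 = q * a + u\<close> with \<open>q\<close> in \<open>S'\<close> and
  \<open>u S = 0\<close>, then \<open>q * a * s = s\<close> on \<open>S\<close>. Hence \<open>p = q * a * p = q\<close>, and this common element is
  the required \<open>x\<close> (\<open>absorbs_if_direct_sums\<close>).

  Evaluating one product such as \<open>y * a * x\<close> in two ways also proves the three uniqueness claims.\<close>

section \<open>Additive subgroups and annihilators\<close>

lemma add_subgroup_left_mult_image:
  assumes "add_subgroup S"
  shows "add_subgroup (left_mult a ` S)"
proof -
  have "a * s + a * t \<in> (*) a ` S" if "s \<in> S" "t \<in> S" for s t
    using assms that by (auto simp: add_subgroup_def distrib_left[symmetric])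
  moreover have "- (a * s) \<in> (*) a ` S" if "s \<in> S" for s
    using assms that by (intro image_eqI[where x = "- s"]) (simp_all add: add_subgroup_def)
  moreover have "0 \<in> (*) a ` S"
    using assms by (auto simp: add_subgroup_def intro!: image_eqI[where x = 0])
  ultimately show ?thesis
    by (auto simp: add_subgroup_def left_mult_def)
qed

lemma add_subgroup_right_mult_image:
  assumes "add_subgroup S"
  shows "add_subgroup (right_mult a ` S)"
proof -
  have "s * a + t * a \<in> (\<lambda>r. r * a) ` S" if "s \<in> S" "t \<in> S" for s t
    using assms that by (auto simp: add_subgroup_def distrib_right[symmetric])
  moreover have "- (s * a) \<in> (\<lambda>r. r * a) ` S" if "s \<in> S" for s
    using assms that by (intro image_eqI[where x = "- s"]) (simp_all add: add_subgroup_def)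
  moreover have "0 \<in> (\<lambda>r. r * a) ` S"
    using assms by (auto simp: add_subgroup_def intro!: image_eqI[where x = 0])
  ultimately show ?thesis
    by (auto simp: add_subgroup_def right_mult_def)
qed

lemma add_subgroup_rann_set: "add_subgroup (rann_set A)"
  by (auto simp: add_subgroup_def rann_set_def distrib_left)

lemma add_subgroup_lann_set: "add_subgroup (lann_set A)"
  by (auto simp: add_subgroup_def lann_set_def distrib_right)

lemma rann_set_principal: "rann_set (right_mult x ` UNIV) = rann x"
proof -
  have "x * r = 0" if "\<forall>q. q * x * r = 0" for r
    using that[THEN spec, of 1] by simp
  then show ?thesis
    by (auto simp: rann_set_def rann_def right_mult_def mult.assoc)
qed

lemma lann_set_principal: "lann_set (left_mult x ` UNIV) = lann x"
proof -
  have "r * x = 0" if "\<forall>q. r * (x * q) = 0" for r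
    using that[THEN spec, of 1] by simp
  then show ?thesis
    by (auto simp: lann_set_def lann_def left_mult_def mult.assoc[symmetric])
qed

section \<open>Absorption laws\<close>

definition absorbs :: "'a::ring_1 \<Rightarrow> 'a set \<Rightarrow> 'a set \<Rightarrow> 'a \<Rightarrow> bool"
  where "absorbs a S S' x \<longleftrightarrow>
    x \<in> S \<inter> S' \<and> (\<forall>s\<in>S. x * a * s = s) \<and> (\<forall>s\<in>S'. s * a * x = s)"

lemma outer_inverse_absorbs_left:
  assumes "x \<in> outer_inverses a" and "s \<in> left_mult x ` UNIV"
  shows "x * a * s = s"
  using assms by (auto simp: outer_inverses_def left_mult_def mult.assoc[symmetric])

lemma outer_inverse_absorbs_right:
  assumes "x \<in> outer_inverses a" and "s \<in> right_mult x ` UNIV"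
  shows "s * a * x = s"
  using assms by (auto simp: outer_inverses_def right_mult_def mult.assoc)

lemma generator_in_left_mult_range: "x \<in> left_mult (x :: 'a::ring_1) ` UNIV"
  by (rule image_eqI[where x = 1]) (simp_all add: left_mult_def)

lemma generator_in_right_mult_range: "x \<in> right_mult (x :: 'a::ring_1) ` UNIV"
  by (rule image_eqI[where x = 1]) (simp_all add: right_mult_def)

text \<open>For the converse implication, \<open>x * a * s = s\<close> exhibits each \<open>s\<close> in \<open>S\<close> as a right multiple of
  \<open>x\<close>, and its instance \<open>s = x\<close> is the outer inverse equation.\<close>

lemma outer_inverse_iff_absorbs:
  assumes "right_ideal S" and "left_ideal S'"
  shows "is_outer_rprin_lprin a S S' x \<longleftrightarrow> absorbs a S S' x"
proof
  assume "is_outer_rprin_lprin a S S' x"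
  then show "absorbs a S S' x"
    using outer_inverse_absorbs_left[of x a] outer_inverse_absorbs_right[of x a]
      generator_in_left_mult_range[of x] generator_in_right_mult_range[of x]
    unfolding is_outer_rprin_lprin_def absorbs_def by blast
next
  assume x: "absorbs a S S' x"
  have "left_mult x ` UNIV = S"
  proof
    show "left_mult x ` UNIV \<subseteq> S"
      using x assms(1) by (auto simp: absorbs_def right_ideal_def left_mult_def)
    show "S \<subseteq> left_mult x ` UNIV"
    proof
      fix s assume "s \<in> S"
      then have "s = left_mult x (a * s)"
        using x by (simp add: absorbs_def left_mult_def mult.assoc)
      then show "s \<in> left_mult x ` UNIV" by blast
    qed
  qed
  moreover have "right_mult x ` UNIV = S'"
  proof
    show "right_mult x ` UNIV \<subseteq> S'"
      using x assms(2) by (auto simp: absorbs_def left_ideal_def right_mult_def)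
    show "S' \<subseteq> right_mult x ` UNIV"
    proof
      fix s assume "s \<in> S'"
      then have "s = right_mult x (s * a)"
        using x by (simp add: absorbs_def right_mult_def)
      then show "s \<in> right_mult x ` UNIV" by blast
    qed
  qed
  ultimately show "is_outer_rprin_lprin a S S' x"
    using x by (auto simp: is_outer_rprin_lprin_def outer_inverses_def absorbs_def)
qed

lemma absorbs_unique:
  assumes "absorbs a S S' x" and "absorbs a S S' y"
  shows "y = x"
proof -
  have "y * a * x = y" using assms unfolding absorbs_def by blast
  moreover have "y * a * x = x" using assms unfolding absorbs_def by blast
  ultimately show ?thesis by simp
qed

section \<open>Direct sum decompositions\<close>

text \<open>A recognition principle serving both sides of the ring at once: a map with values in \<open>A\<close> whose
  error \<open>r - f r\<close> lies in \<open>B\<close> shows \<open>UNIV = A + B\<close>; as \<open>A\<close> and \<open>B\<close> meet only in \<open>0\<close>,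
  components are unique, so the map is the projection.\<close>

lemma is_projI:
  assumes "add_subgroup A" and "add_subgroup B"
    and image: "\<And>r. f r \<in> A" and error: "\<And>r. r - f r \<in> B"
    and trivial: "\<And>r. r \<in> A \<Longrightarrow> r \<in> B \<Longrightarrow> r = 0"
  shows "is_proj f A B"
proof -
  have split: "f r + (r - f r) = r" for r by simp
  have "r \<in> A + B" for r
    using set_plus_intro[OF image[of r] error[of r]] by simp
  moreover have "0 \<in> A" "0 \<in> B"
    using assms(1,2) by (simp_all add: add_subgroup_def)
  ultimately have sum: "direct_sum A B"
    using trivial by (auto simp: direct_sum_def)
  have "f r = proj A B r" for r
    using proj_add[OF assms(1,2) sum image[of r] error[of r]] by simp
  with sum show ?thesis
    by (auto simp: is_proj_def)
qed

lemma absorbs_is_proj_left: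
  assumes "right_ideal S" and x: "absorbs a S S' x"
  shows "is_proj (left_mult (a * x)) (left_mult a ` S) (rann_set S')"
proof (rule is_projI)
  show "add_subgroup (left_mult a ` S)"
    using assms(1) by (auto simp: right_ideal_def intro: add_subgroup_left_mult_image)
  show "add_subgroup (rann_set S')" by (rule add_subgroup_rann_set)
  show "left_mult (a * x) r \<in> left_mult a ` S" for r
    using assms by (auto simp: absorbs_def right_ideal_def left_mult_def mult.assoc)
  show "r - left_mult (a * x) r \<in> rann_set S'" for r
    using x by (auto simp: absorbs_def rann_set_def left_mult_def right_diff_distrib
        mult.assoc[symmetric])
  show "r = 0" if "r \<in> left_mult a ` S" and "r \<in> rann_set S'" for r
  proof -
    obtain s where s: "s \<in> S" "r = a * s"
      using \<open>r \<in> left_mult a ` S\<close> by (auto simp: left_mult_def)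
    \<comment> \<open>As \<open>x\<close> lies in \<open>S'\<close>, it annihilates \<open>r\<close>, yet it recovers \<open>s\<close> from \<open>r = a * s\<close>.\<close>
    have "s = x * r" using x s by (simp add: absorbs_def mult.assoc)
    also have "\<dots> = 0" using x \<open>r \<in> rann_set S'\<close> by (simp add: absorbs_def rann_set_def)
    finally show "r = 0" using s by simp
  qed
qed

lemma absorbs_is_proj_right:
  assumes "left_ideal S'" and x: "absorbs a S S' x"
  shows "is_proj (right_mult (x * a)) (right_mult a ` S') (lann_set S)"
proof (rule is_projI)
  show "add_subgroup (right_mult a ` S')"
    using assms(1) by (auto simp: left_ideal_def intro: add_subgroup_right_mult_image)
  show "add_subgroup (lann_set S)" by (rule add_subgroup_lann_set)
  show "right_mult (x * a) r \<in> right_mult a ` S'" for r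
    using assms by (auto simp: absorbs_def left_ideal_def right_mult_def mult.assoc[symmetric])
  show "r - right_mult (x * a) r \<in> lann_set S" for r
    using x by (auto simp: absorbs_def lann_set_def right_mult_def left_diff_distrib mult.assoc)
  show "r = 0" if "r \<in> right_mult a ` S'" and "r \<in> lann_set S" for r
  proof -
    obtain s where s: "s \<in> S'" "r = s * a"
      using \<open>r \<in> right_mult a ` S'\<close> by (auto simp: right_mult_def)
    have "s = r * x" using x s by (simp add: absorbs_def)
    also have "\<dots> = 0" using x \<open>r \<in> lann_set S\<close> by (simp add: absorbs_def lann_set_def)
    finally show "r = 0" using s by simp
  qed
qed

text \<open>Each decomposition of \<open>1\<close> gives an element satisfying one of the two laws: \<open>p\<close> in \<open>S\<close> acts as
  \<open>s * a * p = s\<close> on \<open>S'\<close>, and \<open>q\<close> in \<open>S'\<close> acts as \<open>q * a * s = s\<close> on \<open>S\<close>. As \<open>p\<close> and \<open>q\<close> lie where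
  the other one acts, \<open>q * a * p\<close> equals both.\<close>

lemma absorbs_if_direct_sums:
  assumes "direct_sum (left_mult a ` S) (rann_set S')"
    and "direct_sum (right_mult a ` S') (lann_set S)"
  shows "\<exists>x. absorbs a S S' x"
proof -
  have "1 \<in> left_mult a ` S + rann_set S'" "1 \<in> right_mult a ` S' + lann_set S"
    using assms unfolding direct_sum_def by blast+
  then obtain p t q u where p: "p \<in> S" and t: "t \<in> rann_set S'" and pt: "1 = a * p + t"
    and q: "q \<in> S'" and u: "u \<in> lann_set S" and qu: "1 = q * a + u"
    by (auto simp: set_plus_def left_mult_def right_mult_def)
  have right: "s * a * p = s" if "s \<in> S'" for s
  proof -
    have "s = s * (a * p + t)" using pt by simp
    also have "\<dots> = s * a * p"
      using t that by (simp add: rann_set_def distrib_left mult.assoc)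
    finally show ?thesis by simp
  qed
  have left: "q * a * s = s" if "s \<in> S" for s
  proof -
    have "s = (q * a + u) * s" using qu by simp
    also have "\<dots> = q * a * s"
      using u that by (simp add: lann_set_def distrib_right)
    finally show ?thesis by simp
  qed
  have "p = q" using left[OF p] right[OF q] by simp
  with p q left right show ?thesis
    by (auto simp: absorbs_def)
qed

section \<open>Outer inverses with prescribed one-sided data\<close>

text \<open>The common range \<open>x R = y R\<close> gives \<open>x * a * y = y\<close>. The second evaluation \<open>x * a * y = x\<close> comes
  from the annihilators: the outer inverse equation of \<open>y\<close> puts \<open>1 - a * y\<close> into \<open>rann y\<close>, hence into
  \<open>rann x\<close>. The left-handed version is the mirror image, with \<open>1 - y * a\<close> in \<open>lann y\<close>.\<close>

lemma outer_rprin_rann_unique: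
  assumes x: "is_outer_rprin_rann a S T x" and y: "is_outer_rprin_rann a S T y"
  shows "y = x"
proof -
  have "x * a * y = y"
    using x y generator_in_left_mult_range[of y]
    by (intro outer_inverse_absorbs_left) (simp_all add: is_outer_rprin_rann_def)
  moreover have "y * (1 - a * y) = 0"
    using y by (simp add: is_outer_rprin_rann_def outer_inverses_def right_diff_distrib mult.assoc)
  then have "x * (1 - a * y) = 0"
    using x y unfolding is_outer_rprin_rann_def rann_def by blast
  ultimately show ?thesis
    by (simp add: right_diff_distrib mult.assoc)
qed

lemma outer_lprin_lann_unique:
  assumes x: "is_outer_lprin_lann a S T x" and y: "is_outer_lprin_lann a S T y"
  shows "y = x"
proof -
  have "y * a * x = y"
    using x y generator_in_right_mult_range[of y]
    by (intro outer_inverse_absorbs_right) (simp_all add: is_outer_lprin_lann_def)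
  moreover have "(1 - y * a) * y = 0"
    using y by (simp add: is_outer_lprin_lann_def outer_inverses_def left_diff_distrib)
  then have "(1 - y * a) * x = 0"
    using x y unfolding is_outer_lprin_lann_def lann_def by blast
  ultimately show ?thesis
    by (simp add: left_diff_distrib)
qed

section \<open>The equivalence theorem\<close>

theorem theorem5p5:
  fixes a :: "'a::ring_1" and S S' :: "'a set"
  assumes "right_ideal S" and "left_ideal S'"
  shows
    "((\<exists>x. is_outer_rprin_lprin a S S' x) \<longleftrightarrow>
        direct_sum (left_mult a ` S) (rann_set S') \<and>
        direct_sum (right_mult a ` S') (lann_set S))
     \<and> ((\<exists>x. is_outer_rprin_lprin a S S' x) \<longleftrightarrow>
        (\<exists>x \<in> S \<inter> S'. (\<forall>s\<in>S. x * a * s = s) \<and> (\<forall>s\<in>S'. s * a * x = s)))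
     \<and> ((\<exists>x. is_outer_rprin_lprin a S S' x) \<longleftrightarrow>
        (\<exists>x \<in> S \<inter> S'.
          is_proj (left_mult (a * x)) (left_mult a ` S) (rann_set S') \<and>
          is_proj (right_mult (x * a)) (right_mult a ` S') (lann_set S)))
     \<and> (\<forall>x. is_outer_rprin_lprin a S S' x \<longrightarrow>
          (\<forall>y. is_outer_rprin_lprin a S S' y \<longrightarrow> y = x) \<and>
          (\<exists>!y. is_outer_rprin_rann a S (rann_set S') y) \<and>
          x = outer_rprin_rann a S (rann_set S') \<and>
          (\<exists>!y. is_outer_lprin_lann a S' (lann_set S) y) \<and>
          x = outer_lprin_lann a S' (lann_set S))"
proof -
  have absorb: "is_outer_rprin_lprin a S S' x \<longleftrightarrow> absorbs a S S' x" for x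
    using outer_inverse_iff_absorbs[OF assms] .
  have projs: "is_proj (left_mult (a * x)) (left_mult a ` S) (rann_set S')"
    "is_proj (right_mult (x * a)) (right_mult a ` S') (lann_set S)" if "absorbs a S S' x" for x
    using absorbs_is_proj_left[OF assms(1) that] absorbs_is_proj_right[OF assms(2) that] .
  have sums: "(\<exists>x. absorbs a S S' x) \<longleftrightarrow>
      direct_sum (left_mult a ` S) (rann_set S') \<and> direct_sum (right_mult a ` S') (lann_set S)"
    using projs absorbs_if_direct_sums by (auto simp: is_proj_def)
  have absorb_ex: "(\<exists>x. absorbs a S S' x) \<longleftrightarrow>
      (\<exists>x \<in> S \<inter> S'. (\<forall>s\<in>S. x * a * s = s) \<and> (\<forall>s\<in>S'. s * a * x = s))"
    by (auto simp: absorbs_def)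
  have proj_ex: "(\<exists>x. absorbs a S S' x) \<longleftrightarrow>
      (\<exists>x \<in> S \<inter> S'.
        is_proj (left_mult (a * x)) (left_mult a ` S) (rann_set S') \<and>
        is_proj (right_mult (x * a)) (right_mult a ` S') (lann_set S))"
  proof
    assume "\<exists>x. absorbs a S S' x"
    then obtain x where "absorbs a S S' x" ..
    moreover from this have "x \<in> S \<inter> S'" by (simp add: absorbs_def)
    ultimately show "\<exists>x \<in> S \<inter> S'.
        is_proj (left_mult (a * x)) (left_mult a ` S) (rann_set S') \<and>
        is_proj (right_mult (x * a)) (right_mult a ` S') (lann_set S)"
      using projs by blast
  next
    \<comment> \<open>Projections along these subgroups include the two decompositions, from which the
      components of \<open>1\<close> yield the element.\<close>
    assume "\<exists>x \<in> S \<inter> S'.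
        is_proj (left_mult (a * x)) (left_mult a ` S) (rann_set S') \<and>
        is_proj (right_mult (x * a)) (right_mult a ` S') (lann_set S)"
    then show "\<exists>x. absorbs a S S' x"
      unfolding sums by (auto simp: is_proj_def)
  qed
  have unique: "(\<forall>y. is_outer_rprin_lprin a S S' y \<longrightarrow> y = x) \<and>
      (\<exists>!y. is_outer_rprin_rann a S (rann_set S') y) \<and>
      x = outer_rprin_rann a S (rann_set S') \<and>
      (\<exists>!y. is_outer_lprin_lann a S' (lann_set S) y) \<and>
      x = outer_lprin_lann a S' (lann_set S)" if x: "is_outer_rprin_lprin a S S' x" for x
  proof -
    have r: "is_outer_rprin_rann a S (rann_set S') x"
      using x rann_set_principal[of x]
      by (simp add: is_outer_rprin_lprin_def is_outer_rprin_rann_def)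
    have l: "is_outer_lprin_lann a S' (lann_set S) x"
      using x lann_set_principal[of x]
      by (simp add: is_outer_rprin_lprin_def is_outer_lprin_lann_def)
    have r1: "\<exists>!y. is_outer_rprin_rann a S (rann_set S') y"
      using r outer_rprin_rann_unique by blast
    have l1: "\<exists>!y. is_outer_lprin_lann a S' (lann_set S) y"
      using l outer_lprin_lann_unique by blast
    have "x = outer_rprin_rann a S (rann_set S')"
      unfolding outer_rprin_rann_def using the1_equality[OF r1 r] by simp
    moreover have "x = outer_lprin_lann a S' (lann_set S)"
      unfolding outer_lprin_lann_def using the1_equality[OF l1 l] by simp
    moreover have "\<forall>y. is_outer_rprin_lprin a S S' y \<longrightarrow> y = x"
      using x absorbs_unique unfolding absorb by blast
    ultimately show ?thesis using r1 l1 by blast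
  qed
  show ?thesis
    using sums absorb_ex proj_ex unique unfolding absorb by blast
qed

end
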